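(* For every fixed $r\in(0,1)$, $$\mathcal{R}_{n,r}\sim\frac{2}{\pi}\,\frac{1+r}{1-r}\,n\qquad\text{as } n\to\infty,$$ i.e. the ratio of the two sides tends to $1$ as $n\to\infty$.
   Context: For a complex $n\times n$ matrix $T$, $\|T\|$ is the operator norm associated with the standard Hilbert (Euclidean) norm on $\mathbb{C}^{n}$, $\sigma(T)$ is the spectrum, and $\rho(T)=\max_{\lambda\in\sigma(T)}|\lambda|$ is the spectral radius. $\mathcal{C}_{n}$ is the set of complex $n\times n$ matrices $T$ with $\|T\|\leq1$ (contractions). For $\zeta\notin\sigma(T)$, $R(\zeta,T)=(\zeta-T)^{-1}$, where a scalar $\zeta$ stands for $\zeta$ times the identity matrix. For $n\geq1$ and $r\in(0,1)$, $$\mathcal{R}_{n,r}:=\sup\{\|R(\zeta,T)\| : T\in\mathcal{C}_{n},\ \rho(T)\leq r\},$$ where $\zeta$ is any complex number with $|\zeta|=1$ (the value does not depend on the choice of such $\zeta$). *)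

theory Defs
  imports
    "Jordan_Normal_Form.Spectral_Radius"
    "Jordan_Normal_Form.Gauss_Jordan_Elimination"
    "HOL-Analysis.L2_Norm"
    "HOL-Library.Landau_Symbols"
begin

definition euclid_norm :: "complex vec \<Rightarrow> real" where
  "euclid_norm v = L2_set (\<lambda>i. cmod (v $ i)) {..<dim_vec v}"

definition op_norm :: "complex mat \<Rightarrow> real" where
  "op_norm A = (SUP v \<in> {v \<in> carrier_vec (dim_col A). euclid_norm v \<le> 1}. euclid_norm (A *\<^sub>v v))"

definition contractions :: "nat \<Rightarrow> complex mat set" where
  "contractions n = {T \<in> carrier_mat n n. op_norm T \<le> 1}"

text \<open>Only meaningful for a square matrix \<open>T\<close> and \<open>\<zeta>\<close> outside its spectrum; otherwise
  \<^const>\<open>mat_inverse\<close> returns \<^const>\<open>None\<close>.\<close>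

definition resolvent :: "complex \<Rightarrow> complex mat \<Rightarrow> complex mat" where
  "resolvent \<zeta> T = the (mat_inverse (\<zeta> \<cdot>\<^sub>m 1\<^sub>m (dim_row T) - T))"

text \<open>For \<open>\<bar>\<zeta>\<bar> = 1\<close> the value does not depend on \<open>\<zeta>\<close>, since \<open>T \<mapsto> c T\<close> with \<open>\<bar>c\<bar> = 1\<close> preserves
  both constraints; here \<open>\<zeta>\<close> is kept as a parameter. For \<open>n \<ge> 1\<close>, \<open>0 < r < 1\<close> and \<open>\<bar>\<zeta>\<bar> = 1\<close> the set
  is nonempty and bounded, so the real supremum is the intended one. For \<open>n = 0\<close> the spectrum is
  empty and the spectral radius is an unspecified value.\<close>

definition max_resolvent :: "complex \<Rightarrow> nat \<Rightarrow> real \<Rightarrow> real" where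
  "max_resolvent \<zeta> n r =
     (SUP T \<in> {T \<in> contractions n. spectral_radius T \<le> r}. op_norm (resolvent \<zeta> T))"

end

theory Submission
  imports Defs "HOL-Real_Asymp.Real_Asymp"
begin

text \<open>
  For \<open>\<bar>\<zeta>\<bar> = 1\<close> pass to the Cayley transform \<open>A = 2 \<zeta> R(\<zeta>, T) - 1\<close>. It is accretive
  exactly when \<open>T\<close> is a contraction, and \<open>\<rho>(T) \<le> r\<close> confines its eigenvalues to
  \<open>\<bar>a\<bar> \<le> K = (1 + r) / (1 - r)\<close>. In a unitary Schur form of \<open>A\<close> the diagonal entries are at most
  \<open>K\<close> and accretivity forces the entries above the diagonal to be at most \<open>2 K\<close>, so \<open>\<parallel>A\<parallel>\<close> is at most
  the norm of the triangular matrix with exactly these entries. By a discrete Wirtinger inequality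
  that norm is \<open>K cot (\<pi> / (4 n))\<close>. The triangular matrix is itself accretive with spectrum \<open>{K}\<close>, so
  its inverse Cayley transform shows that the bound is sharp up to an additive constant.
\<close>

section \<open>Euclidean norm and operator norm\<close>

lemma euclid_norm_square: "(euclid_norm v)\<^sup>2 = (\<Sum>i<dim_vec v. (cmod (v $ i))\<^sup>2)"
  by (simp add: euclid_norm_def L2_set_def sum_nonneg)

lemma euclid_norm_nonneg [simp]: "0 \<le> euclid_norm v"
  by (simp add: euclid_norm_def)

lemma euclid_norm_smult: "euclid_norm (c \<cdot>\<^sub>v v) = cmod c * euclid_norm v"
proof -
  have "euclid_norm (c \<cdot>\<^sub>v v) = L2_set (\<lambda>i. cmod c * cmod (v $ i)) {..<dim_vec v}"
    unfolding euclid_norm_def by (rule L2_set_cong) (auto simp: norm_mult)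
  then show ?thesis by (simp add: euclid_norm_def L2_set_right_distrib)
qed

lemma euclid_norm_zero [simp]: "euclid_norm (0\<^sub>v n) = 0"
  by (simp add: euclid_norm_def L2_set_def)

lemma euclid_norm_eq_0_iff:
  assumes "v \<in> carrier_vec n"
  shows "euclid_norm v = 0 \<longleftrightarrow> v = 0\<^sub>v n"
  using assms by (auto simp: euclid_norm_def L2_set_eq_0_iff)

lemma euclid_norm_add_le:
  assumes "u \<in> carrier_vec n" "v \<in> carrier_vec n"
  shows "euclid_norm (u + v) \<le> euclid_norm u + euclid_norm v"
proof -
  have "euclid_norm (u + v) = L2_set (\<lambda>i. cmod (u $ i + v $ i)) {..<n}"
    unfolding euclid_norm_def using assms by (auto intro!: L2_set_cong)
  also have "\<dots> \<le> L2_set (\<lambda>i. cmod (u $ i) + cmod (v $ i)) {..<n}"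
    by (intro L2_set_mono norm_triangle_ineq) auto
  also have "\<dots> \<le> euclid_norm u + euclid_norm v"
    unfolding euclid_norm_def using assms L2_set_triangle_ineq by auto
  finally show ?thesis .
qed

text \<open>Polarization: the squared norms of \<open>u + v\<close> and \<open>u - v\<close> differ
  by 4 Re <u, v>. For \<open>u = A v\<close> the right-hand side is the usual accretivity of
  \<open>A\<close>. The left-hand side is the form used below, because isometries preserve it and
  the Cayley transform turns it into a contraction estimate.\<close>

lemma euclid_norm_diff_le_add_iff:
  assumes "u \<in> carrier_vec n" "v \<in> carrier_vec n"
  shows "euclid_norm (u - v) \<le> euclid_norm (u + v) \<longleftrightarrow> 0 \<le> (\<Sum>i<n. Re (u $ i * cnj (v $ i)))"
proof -
  have "(euclid_norm (u + v))\<^sup>2 - (euclid_norm (u - v))\<^sup>2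
      = (\<Sum>i<n. (cmod (u $ i + v $ i))\<^sup>2 - (cmod (u $ i - v $ i))\<^sup>2)"
    using assms by (simp add: euclid_norm_square sum_subtractf)
  also have "\<dots> = (\<Sum>i<n. 4 * Re (u $ i * cnj (v $ i)))"
    by (intro sum.cong) (auto simp: cmod_power2, simp add: power2_eq_square algebra_simps)
  finally have eq: "(euclid_norm (u + v))\<^sup>2 - (euclid_norm (u - v))\<^sup>2
      = 4 * (\<Sum>i<n. Re (u $ i * cnj (v $ i)))"
    by (simp add: sum_distrib_left)
  have "euclid_norm (u - v) \<le> euclid_norm (u + v)
      \<longleftrightarrow> (euclid_norm (u - v))\<^sup>2 \<le> (euclid_norm (u + v))\<^sup>2"
    by (metis euclid_norm_nonneg power2_le_imp_le power_mono)
  with eq show ?thesis by linarith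
qed

lemma mult_mat_vec_nth:
  assumes "A \<in> carrier_mat m n" "v \<in> carrier_vec n" "i < m"
  shows "(A *\<^sub>v v) $ i = (\<Sum>j<n. A $$ (i, j) * v $ j)"
  using assms by (auto simp: scalar_prod_def lessThan_atLeast0 intro!: sum.cong)

text \<open>A crude constant suffices, here the sum of the moduli of all entries. It makes the set
  under the real supremum in \<open>op_norm\<close> bounded above, so that this supremum really
  dominates its members.\<close>

lemma euclid_norm_mult_mat_vec_bounded:
  assumes A: "A \<in> carrier_mat m n"
  shows "\<exists>C. \<forall>v \<in> carrier_vec n. euclid_norm (A *\<^sub>v v) \<le> C * euclid_norm v"
proof (intro exI ballI)
  fix v :: "complex vec" assume v: "v \<in> carrier_vec n"
  have coord: "cmod (v $ j) \<le> euclid_norm v" if "j < n" for j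
    unfolding euclid_norm_def by (rule member_le_L2_set) (use v that in auto)
  have "euclid_norm (A *\<^sub>v v) \<le> (\<Sum>i<m. cmod ((A *\<^sub>v v) $ i))"
    unfolding euclid_norm_def using A L2_set_le_sum[of "{..<m}"] by (simp del: index_mult_mat_vec)
  also have "\<dots> \<le> (\<Sum>i<m. \<Sum>j<n. cmod (A $$ (i, j)) * euclid_norm v)"
  proof (intro sum_mono)
    fix i assume "i \<in> {..<m}"
    then have "cmod ((A *\<^sub>v v) $ i) \<le> (\<Sum>j<n. cmod (A $$ (i, j)) * cmod (v $ j))"
      using mult_mat_vec_nth[OF A v, of i] norm_sum[of "\<lambda>j. A $$ (i, j) * v $ j" "{..<n}"]
      by (simp add: norm_mult)
    also have "\<dots> \<le> (\<Sum>j<n. cmod (A $$ (i, j)) * euclid_norm v)"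
      using coord by (intro sum_mono mult_left_mono) auto
    finally show "cmod ((A *\<^sub>v v) $ i) \<le> \<dots>" .
  qed
  finally show "euclid_norm (A *\<^sub>v v) \<le> (\<Sum>i<m. \<Sum>j<n. cmod (A $$ (i, j))) * euclid_norm v"
    by (simp add: sum_distrib_right)
qed

lemma op_norm_le:
  assumes A: "A \<in> carrier_mat m n" and "0 \<le> C"
    and bound: "\<And>v. v \<in> carrier_vec n \<Longrightarrow> euclid_norm (A *\<^sub>v v) \<le> C * euclid_norm v"
  shows "op_norm A \<le> C"
  unfolding op_norm_def
proof (rule cSUP_least)
  have "0\<^sub>v n \<in> {v \<in> carrier_vec (dim_col A). euclid_norm v \<le> 1}" using A by auto
  then show "{v \<in> carrier_vec (dim_col A). euclid_norm v \<le> 1} \<noteq> {}" by blast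
next
  fix v assume v: "v \<in> {v \<in> carrier_vec (dim_col A). euclid_norm v \<le> 1}"
  then have "euclid_norm (A *\<^sub>v v) \<le> C * euclid_norm v" using A bound by auto
  also have "\<dots> \<le> C" using v \<open>0 \<le> C\<close> by (simp add: mult_left_le)
  finally show "euclid_norm (A *\<^sub>v v) \<le> C" .
qed

lemma euclid_norm_mult_le_op_norm:
  assumes A: "A \<in> carrier_mat m n" and v: "v \<in> carrier_vec n"
  shows "euclid_norm (A *\<^sub>v v) \<le> op_norm A * euclid_norm v"
proof (cases "v = 0\<^sub>v n")
  case True
  then have "A *\<^sub>v v = 0\<^sub>v m" using A by (intro eq_vecI) auto
  with True show ?thesis by simp
next
  case False
  then have pos: "euclid_norm v > 0"
    using euclid_norm_eq_0_iff[OF v] by (simp add: less_le)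
  obtain C where C: "\<And>v. v \<in> carrier_vec n \<Longrightarrow> euclid_norm (A *\<^sub>v v) \<le> C * euclid_norm v"
    using euclid_norm_mult_mat_vec_bounded[OF A] by blast
  define c where "c = complex_of_real (1 / euclid_norm v)"
  let ?B = "{v \<in> carrier_vec (dim_col A). euclid_norm v \<le> 1}"
  have c: "cmod c = 1 / euclid_norm v" unfolding c_def norm_of_real using pos by simp
  have "bdd_above ((\<lambda>v. euclid_norm (A *\<^sub>v v)) ` ?B)"
  proof (rule bdd_aboveI2)
    fix w assume w: "w \<in> ?B"
    then have "euclid_norm (A *\<^sub>v w) \<le> C * euclid_norm w" using A C by auto
    also have "\<dots> \<le> \<bar>C\<bar> * 1" using w by (intro mult_mono) auto
    finally show "euclid_norm (A *\<^sub>v w) \<le> \<bar>C\<bar>" by simp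
  qed
  moreover have "c \<cdot>\<^sub>v v \<in> ?B" using A v pos by (auto simp: euclid_norm_smult c)
  ultimately have "euclid_norm (A *\<^sub>v (c \<cdot>\<^sub>v v)) \<le> op_norm A"
    unfolding op_norm_def by (rule cSUP_upper[rotated])
  then show ?thesis
    using pos by (simp add: mult_mat_vec[OF A v] euclid_norm_smult c field_simps)
qed

section \<open>A discrete Wirtinger inequality and its extremal sequence\<close>

text \<open>With \<phi> = pi / (4 n) and \<theta> = 2 \<phi>, multiplying by sin^2 \<phi> and using
  the half-angle formulas turns the claim into nonnegativity of the sum of \<open>cos \<theta> * ((s
  i)\<^sup>2 + (s (Suc i))\<^sup>2) - 2 * s i * s (Suc i)\<close>. This quadratic form vanishes on
  the sequence sin (k \<theta>), which is 0 at k = 0 and reaches its peak at k = n.\<close>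

lemma discrete_wirtinger:
  fixes s :: "nat \<Rightarrow> real"
  assumes n: "0 < n" and s0: "s 0 = 0"
  shows "(\<Sum>i<n. (s i + s (Suc i))\<^sup>2) \<le> (cot (pi / (4 * real n)))\<^sup>2 * (\<Sum>i<n. (s (Suc i) - s i)\<^sup>2)"
proof -
  define \<phi> where "\<phi> = pi / (4 * real n)"
  define \<theta> where "\<theta> = 2 * \<phi>"
  have \<phi>: "0 < \<phi>" "\<phi> < pi" using n by (auto simp: \<phi>_def field_simps)
  have sin_pos: "sin (real k * \<theta>) > 0" if "0 < k" "k \<le> n" for k
  proof (rule sin_gt_zero)
    show "0 < real k * \<theta>" using that \<phi> by (simp add: \<theta>_def)
    have "real k * \<theta> \<le> real n * \<theta>" using that \<phi> by (simp add: \<theta>_def mult_right_mono)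
    also have "\<dots> = pi / 2" using n by (simp add: \<theta>_def \<phi>_def)
    finally show "real k * \<theta> < pi" using pi_gt_zero by linarith
  qed
  \<comment> \<open>Picone's identity with the extremal sequence \<open>sin (k \<theta>)\<close>: each summand dominates a
    telescoping difference.\<close>
  have telescope: "sin \<theta> * cot (real m * \<theta>) * (s m)\<^sup>2
      \<le> (\<Sum>i<m. cos \<theta> * ((s i)\<^sup>2 + (s (Suc i))\<^sup>2) - 2 * s i * s (Suc i))"
    if "0 < m" "m \<le> n" for m
    using that
  proof (induction m rule: nat_induct_non_zero)
    case 1
    then show ?case using sin_pos[of 1] s0 by (simp add: cot_def)
  next
    case (Suc m)
    define a where "a = sin (real m * \<theta>)"
    define b where "b = sin (real (Suc m) * \<theta>)"
    have pos: "a > 0" "b > 0" using Suc sin_pos by (auto simp: a_def b_def simp del: of_nat_Suc)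
    have b: "b = a * cos \<theta> + cos (real m * \<theta>) * sin \<theta>"
      by (simp add: a_def b_def distrib_right sin_add add.commute)
    have a: "a = b * cos \<theta> - cos (real (Suc m) * \<theta>) * sin \<theta>"
      using sin_diff[of "real (Suc m) * \<theta>" \<theta>] by (simp add: a_def b_def algebra_simps)
    \<comment> \<open>The addition formulas express the boundary terms at \<open>m\<close> and
      \<open>Suc m\<close> through the ratios of neighbouring sines. Their difference is then short
      of the new summand by exactly the square in the next step, which is zero when \<open>s\<close>
      is proportional to the sine sequence.\<close>
    have cot_m: "sin \<theta> * cot (real m * \<theta>) = b / a - cos \<theta>"
      using pos unfolding b cot_def a_def[symmetric] by (simp add: field_simps)
    have cot_Suc: "sin \<theta> * cot (real (Suc m) * \<theta>) = cos \<theta> - a / b"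
      using pos unfolding cot_def b_def[symmetric] by (subst a) (simp add: field_simps)
    have "0 \<le> (b * s m - a * s (Suc m))\<^sup>2 / (a * b)" using pos by simp
    also have "\<dots> = b / a * (s m)\<^sup>2 + a / b * (s (Suc m))\<^sup>2 - 2 * s m * s (Suc m)"
      using pos by (simp add: field_simps power2_eq_square)
    finally have "sin \<theta> * cot (real (Suc m) * \<theta>) * (s (Suc m))\<^sup>2 \<le>
        sin \<theta> * cot (real m * \<theta>) * (s m)\<^sup>2
        + (cos \<theta> * ((s m)\<^sup>2 + (s (Suc m))\<^sup>2) - 2 * s m * s (Suc m))"
      unfolding cot_m cot_Suc by (simp add: algebra_simps)
    also have "\<dots> \<le> (\<Sum>i<Suc m. cos \<theta> * ((s i)\<^sup>2 + (s (Suc i))\<^sup>2) - 2 * s i * s (Suc i))"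
      using Suc by simp
    finally show ?case .
  qed
  \<comment> \<open>The angle was chosen so that the cotangent in the boundary term vanishes at the
    last index; the telescoped lower bound is then 0.\<close>
  have "real n * \<theta> = pi / 2" using n by (simp add: \<theta>_def \<phi>_def)
  then have "cot (real n * \<theta>) = 0" unfolding cot_def by (metis cos_pi_half div_0)
  then have "0 \<le> (\<Sum>i<n. cos \<theta> * ((s i)\<^sup>2 + (s (Suc i))\<^sup>2) - 2 * s i * s (Suc i))"
    using telescope[of n] n by simp
  also have "\<dots> = (\<Sum>i<n. (cos \<phi>)\<^sup>2 * (s (Suc i) - s i)\<^sup>2 - (sin \<phi>)\<^sup>2 * (s i + s (Suc i))\<^sup>2)"
  proof (intro sum.cong refl)
    fix i
    have c: "cos \<theta> = (cos \<phi>)\<^sup>2 - (sin \<phi>)\<^sup>2" by (simp add: \<theta>_def cos_double)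
    have "(cos \<phi>)\<^sup>2 * (s (Suc i) - s i)\<^sup>2 - (sin \<phi>)\<^sup>2 * (s i + s (Suc i))\<^sup>2
       = ((cos \<phi>)\<^sup>2 - (sin \<phi>)\<^sup>2) * ((s i)\<^sup>2 + (s (Suc i))\<^sup>2)
         - 2 * s i * s (Suc i) * ((sin \<phi>)\<^sup>2 + (cos \<phi>)\<^sup>2)"
      by (simp only: power2_diff power2_sum ring_distribs) (simp add: algebra_simps)
    then show "cos \<theta> * ((s i)\<^sup>2 + (s (Suc i))\<^sup>2) - 2 * s i * s (Suc i)
       = (cos \<phi>)\<^sup>2 * (s (Suc i) - s i)\<^sup>2 - (sin \<phi>)\<^sup>2 * (s i + s (Suc i))\<^sup>2"
      unfolding c by simp
  qed
  finally have "(sin \<phi>)\<^sup>2 * (\<Sum>i<n. (s i + s (Suc i))\<^sup>2) \<le> (cos \<phi>)\<^sup>2 * (\<Sum>i<n. (s (Suc i) - s i)\<^sup>2)"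
    by (simp add: sum_subtractf sum_distrib_left)
  then have "(\<Sum>i<n. (s i + s (Suc i))\<^sup>2) \<le> (cot \<phi>)\<^sup>2 * (\<Sum>i<n. (s (Suc i) - s i)\<^sup>2)"
    using sin_gt_zero[OF \<phi>] by (simp add: cot_def power_divide field_simps)
  then show ?thesis unfolding \<phi>_def .
qed

text \<open>Around the midpoint angle (2 i + 1) \<phi>, the sum of neighbours is 2 cos \<phi> times
  a sine and their difference is 2 sin \<phi> times the cosine of the same angle. Reversing the
  index replaces this angle by its complement to pi / 2, so the squared sines and the squared
  cosines have the same total and only the factor cot^2 \<phi> remains.\<close>

lemma sin_steps_wirtinger_eq:
  fixes n :: nat
  assumes n: "0 < n"
  defines "s \<equiv> \<lambda>k. sin (real k * (pi / (2 * real n)))"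
  shows "(\<Sum>i<n. (s i + s (Suc i))\<^sup>2) = (cot (pi / (4 * real n)))\<^sup>2 * (\<Sum>i<n. (s (Suc i) - s i)\<^sup>2)"
proof -
  define \<phi> where "\<phi> = pi / (4 * real n)"
  have \<phi>: "0 < \<phi>" "\<phi> < pi" using n by (auto simp: \<phi>_def field_simps)
  have add: "s i + s (Suc i) = 2 * cos \<phi> * sin (real (2 * i + 1) * \<phi>)" for i
  proof -
    have "s i = sin (real (2 * i + 1) * \<phi> - \<phi>)" "s (Suc i) = sin (real (2 * i + 1) * \<phi> + \<phi>)"
      unfolding s_def \<phi>_def using n by (auto intro!: arg_cong[of _ _ sin] simp: field_simps)
    then show ?thesis by (simp add: sin_add sin_diff)
  qed
  have diff: "s (Suc i) - s i = 2 * sin \<phi> * cos (real (2 * i + 1) * \<phi>)" for i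
  proof -
    have "s i = sin (real (2 * i + 1) * \<phi> - \<phi>)" "s (Suc i) = sin (real (2 * i + 1) * \<phi> + \<phi>)"
      unfolding s_def \<phi>_def using n by (auto intro!: arg_cong[of _ _ sin] simp: field_simps)
    then show ?thesis by (simp add: sin_add sin_diff)
  qed
  have "(\<Sum>i<n. (sin (real (2 * i + 1) * \<phi>))\<^sup>2) = (\<Sum>i<n. (sin (real (2 * (n - Suc i) + 1) * \<phi>))\<^sup>2)"
    by (rule sum.nat_diff_reindex[symmetric])
  also have "\<dots> = (\<Sum>i<n. (cos (real (2 * i + 1) * \<phi>))\<^sup>2)"
  proof (intro sum.cong refl)
    fix i assume "i \<in> {..<n}"
    then have "real (2 * (n - Suc i) + 1) * \<phi> = pi / 2 - real (2 * i + 1) * \<phi>"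
      using n by (simp add: of_nat_diff \<phi>_def field_simps)
    then show "(sin (real (2 * (n - Suc i) + 1) * \<phi>))\<^sup>2 = (cos (real (2 * i + 1) * \<phi>))\<^sup>2"
      by (simp add: cos_sin_eq)
  qed
  finally show ?thesis
    using sin_gt_zero[OF \<phi>] unfolding add diff power_mult_distrib sum_distrib_left[symmetric]
    by (simp add: \<phi>_def[symmetric] cot_def power_divide)
qed

section \<open>Unitary Schur form\<close>

lemma euclid_norm_mult_orthonormal:
  assumes W: "W \<in> carrier_mat n n" and v: "v \<in> carrier_vec n"
    and orth: "\<And>i j. i < n \<Longrightarrow> j < n \<Longrightarrow> col W i \<bullet>c col W j = (if i = j then 1 else 0)"
  shows "euclid_norm (W *\<^sub>v v) = euclid_norm v"
proof -
  have sq: "complex_of_real ((euclid_norm u)\<^sup>2) = (\<Sum>k<n. u $ k * cnj (u $ k))"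
    if "u \<in> carrier_vec n" for u
    using that by (simp add: euclid_norm_square complex_norm_square[symmetric])
  have cols: "(\<Sum>k<n. W $$ (k, i) * cnj (W $$ (k, j))) = (if i = j then 1 else 0)"
    if "i < n" "j < n" for i j
  proof -
    have "(\<Sum>k<n. W $$ (k, i) * cnj (W $$ (k, j))) = col W i \<bullet>c col W j"
      using W that by (auto simp: scalar_prod_def lessThan_atLeast0 intro!: sum.cong)
    with orth[OF that] show ?thesis by simp
  qed
  have "complex_of_real ((euclid_norm (W *\<^sub>v v))\<^sup>2)
      = (\<Sum>k<n. (\<Sum>i<n. W $$ (k, i) * v $ i) * (\<Sum>j<n. cnj (W $$ (k, j)) * cnj (v $ j)))"
    by (subst sq) (use W v in \<open>auto simp: mult_mat_vec_nth simp del: index_mult_mat_vec intro!: sum.cong\<close>)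
  also have "\<dots> = (\<Sum>k<n. \<Sum>i<n. \<Sum>j<n. v $ i * cnj (v $ j) * (W $$ (k, i) * cnj (W $$ (k, j))))"
    by (simp add: sum_product mult_ac)
  also have "\<dots> = (\<Sum>i<n. \<Sum>k<n. \<Sum>j<n. v $ i * cnj (v $ j) * (W $$ (k, i) * cnj (W $$ (k, j))))"
    by (rule sum.swap)
  also have "\<dots> = (\<Sum>i<n. \<Sum>j<n. \<Sum>k<n. v $ i * cnj (v $ j) * (W $$ (k, i) * cnj (W $$ (k, j))))"
    by (intro sum.cong refl sum.swap)
  also have "\<dots> = (\<Sum>i<n. \<Sum>j<n. v $ i * cnj (v $ j) * (if i = j then 1 else 0))"
    by (intro sum.cong refl) (auto simp: sum_distrib_left[symmetric] cols)
  also have "\<dots> = (\<Sum>i<n. v $ i * cnj (v $ i))"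
    by (intro sum.cong refl) (simp add: if_distrib cong: if_cong)
  also have "\<dots> = complex_of_real ((euclid_norm v)\<^sup>2)" using sq[OF v] by simp
  finally have "(euclid_norm (W *\<^sub>v v))\<^sup>2 = (euclid_norm v)\<^sup>2" by (simp only: of_real_eq_iff)
  then show ?thesis by (simp add: power2_eq_iff_nonneg)
qed

text \<open>An eigenvector is completed to a basis, orthogonalised by Gram-Schmidt and normalised;
  it stays the first basis vector up to scaling, which gives the first column of the transformed
  matrix. Normalising makes \<open>W\<close> an isometry, so the change of basis respects
  norms.\<close>

lemma unitary_deflation:
  fixes A :: "complex mat"
  assumes A: "A \<in> carrier_mat n n" and n: "0 < n"
  obtains W W' e where "W \<in> carrier_mat n n" "W' \<in> carrier_mat n n" "W' * W = 1\<^sub>m n" "W * W' = 1\<^sub>m n"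
    "\<And>v. v \<in> carrier_vec n \<Longrightarrow> euclid_norm (W *\<^sub>v v) = euclid_norm v"
    "col (W' * A * W) 0 = vec n (\<lambda>i. if i = 0 then e else 0)"
proof -
  obtain e v where ev: "eigenvector A v e"
    using spectrum_non_empty[OF A n] unfolding spectrum_def eigenvalue_def by auto
  then have v: "v \<in> carrier_vec n" and v0: "v \<noteq> 0\<^sub>v n" and Av: "A *\<^sub>v v = e \<cdot>\<^sub>v v"
    using A by (auto simp: eigenvector_def)
  interpret cof_vec_space n "TYPE(complex)" .
  define b where "b = basis_completion v"
  define us where "us = gram_schmidt n b"
  from basis_completion[OF v v0, folded b_def]
  have span_b: "span (set b) = carrier_vec n" and dist_b: "distinct b"
    and indep: "\<not> lin_dep (set b)" and b: "set b \<subseteq> carrier_vec n" and hdb: "hd b = v"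
    and len_b: "length b = n" by auto
  from hdb len_b n obtain vs where bv: "b = v # vs" by (cases b, auto)
  from gram_schmidt_result[OF b dist_b indep refl, folded us_def]
  have us: "set us \<subseteq> carrier_vec n" "corthogonal us" "length us = n"
    by (auto simp: len_b)
  from gram_schmidt_hd[OF v, of vs, folded bv] have hdus: "hd us = v" unfolding us_def .
  define c where "c u = complex_of_real (1 / euclid_norm u)" for u
  define ws where "ws = map (\<lambda>u. c u \<cdot>\<^sub>v u) us"
  define W where "W = mat_of_cols n ws"
  define W' where "W' = corthogonal_inv W"
  have usi: "us ! i \<in> carrier_vec n" if "i < n" for i using us that by (metis nth_mem subsetD)
  have sq: "u \<bullet>c u = (complex_of_real (euclid_norm u))\<^sup>2" if "u \<in> carrier_vec n" for u
    using that
    by (simp add: scalar_prod_def euclid_norm_square lessThan_atLeast0 complex_norm_square of_real_power[symmetric]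
        del: of_real_power)
  have pos: "euclid_norm (us ! i) \<noteq> 0" if "i < n" for i
    using corthogonalD[OF us(2), of i i] us(3) that sq[OF usi[OF that]] by auto
  have orth: "ws ! i \<bullet>c ws ! j = (if i = j then 1 else 0)" if ij: "i < n" "j < n" for i j
  proof -
    have "ws ! i \<bullet>c ws ! j = c (us ! i) * (c (us ! j) * (us ! i \<bullet>c us ! j))"
      using us(3) ij smult_scalar_prod_distrib[OF usi[OF ij(1)], of "conjugate (c (us ! j) \<cdot>\<^sub>v us ! j)"]
        scalar_prod_smult_distrib[OF usi[OF ij(1)], of "conjugate (us ! j)"] usi[OF ij(2)]
      by (simp add: ws_def conjugate_smult_vec c_def)
    moreover have "us ! i \<bullet>c us ! j = 0" if "i \<noteq> j"
      using corthogonalD[OF us(2), of i j] us(3) ij that by auto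
    ultimately show ?thesis
      using sq[OF usi[OF ij(1)]] pos[OF ij(1)] by (auto simp: c_def power2_eq_square)
  qed
  have ws: "set ws \<subseteq> carrier_vec n" "length ws = n"
    using us by (auto simp: ws_def)
  have cws: "corthogonal ws" by (rule corthogonalI) (simp add: orth ws(2))
  have W: "W \<in> carrier_mat n n" using ws by (auto simp: W_def)
  have W': "W' \<in> carrier_mat n n"
    unfolding W'_def corthogonal_inv_def using W by (auto simp: mat_of_rows_def)
  have "inverts_mat W' W"
    unfolding W'_def W_def using ws cws corthogonal_inv_result orthogonal_mat_of_cols by blast
  then have W'W: "W' * W = 1\<^sub>m n" using W' by (simp add: inverts_mat_def)
  have us0: "us ! 0 = v" using hdus us n by (cases us) auto
  have w: "hd ws = c v \<cdot>\<^sub>v v" using us0 us n by (cases us) (auto simp: ws_def)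
  have w0: "c v \<cdot>\<^sub>v v \<noteq> 0\<^sub>v n"
  proof
    assume "c v \<cdot>\<^sub>v v = 0\<^sub>v n"
    then have "euclid_norm (c v \<cdot>\<^sub>v v) = 0" by simp
    then show False using pos[OF n] by (simp add: us0 euclid_norm_smult c_def)
  qed
  have Aw: "A *\<^sub>v (c v \<cdot>\<^sub>v v) = e \<cdot>\<^sub>v (c v \<cdot>\<^sub>v v)"
    using mult_mat_vec[OF A v] Av by (simp add: smult_smult_assoc mult.commute)
  show thesis
  proof (rule that[OF W W' W'W mat_mult_left_right_inverse[OF W' W W'W]])
    show "euclid_norm (W *\<^sub>v v) = euclid_norm v" if "v \<in> carrier_vec n" for v
      using W that orth usi us ws
      by (intro euclid_norm_mult_orthonormal) (auto simp: W_def subset_iff)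
    show "col (W' * A * W) 0 = vec n (\<lambda>i. if i = 0 then e else 0)"
      unfolding W'_def W_def using v n ws cws
      by (intro corthogonal_col_ev_0[OF A _ w0 Aw _ w]) auto
  qed
qed

lemma euclid_norm_append:
  assumes "u \<in> carrier_vec m" "v \<in> carrier_vec n"
  shows "(euclid_norm (u @\<^sub>v v))\<^sup>2 = (euclid_norm u)\<^sup>2 + (euclid_norm v)\<^sup>2"
proof -
  have "(euclid_norm (u @\<^sub>v v))\<^sup>2 = (\<Sum>i<m + n. (cmod ((u @\<^sub>v v) $ i))\<^sup>2)"
    using assms by (simp add: euclid_norm_square)
  also have "\<dots> = (\<Sum>i<m. (cmod ((u @\<^sub>v v) $ i))\<^sup>2) + (\<Sum>i<n. (cmod ((u @\<^sub>v v) $ (m + i)))\<^sup>2)"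
    by (induction n) simp_all
  finally show ?thesis
    using assms by (simp add: euclid_norm_square)
qed

text \<open>Deflation clears the first column below the diagonal, and the induction hypothesis
  triangularises the remaining block \<open>A3\<close>. Its isometry \<open>P\<close> is extended by
  a 1 in the corner, and Pythagoras on the two parts of a vector shows that the extension is again
  an isometry.\<close>

lemma unitary_schur_decomposition:
  fixes A :: "complex mat"
  assumes "A \<in> carrier_mat n n"
  shows "\<exists>B P Q. similar_mat_wit A B P Q \<and> upper_triangular B
    \<and> (\<forall>v \<in> carrier_vec n. euclid_norm (P *\<^sub>v v) = euclid_norm v)"
  using assms
proof (induction n arbitrary: A)
  case 0
  then have "similar_mat_wit A A (1\<^sub>m 0) (1\<^sub>m 0)" by (rule similar_mat_wit_refl)
  moreover have "upper_triangular A" using 0 by auto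
  ultimately show ?case by (intro exI[of _ A] exI[of _ "1\<^sub>m 0"]) auto
next
  case (Suc n)
  obtain W W' e where W: "W \<in> carrier_mat (Suc n) (Suc n)" "W' \<in> carrier_mat (Suc n) (Suc n)"
    and inv: "W' * W = 1\<^sub>m (Suc n)" "W * W' = 1\<^sub>m (Suc n)"
    and iso: "\<And>v. v \<in> carrier_vec (Suc n) \<Longrightarrow> euclid_norm (W *\<^sub>v v) = euclid_norm v"
    and col0: "col (W' * A * W) 0 = vec (Suc n) (\<lambda>i. if i = 0 then e else 0)"
    using unitary_deflation[OF Suc.prems] by blast
  define A' where "A' = W' * A * W"
  have A': "A' \<in> carrier_mat (Suc n) (Suc n)" using W Suc.prems by (auto simp: A'_def)
  have "similar_mat_wit A' A W' W"
    by (rule similar_mat_witI[of _ _ "Suc n"]) (use W inv A' Suc.prems in \<open>auto simp: A'_def\<close>)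
  then have simA: "similar_mat_wit A A' W W'" by (rule similar_mat_wit_sym)
  obtain A1 A2 A0 A3 where split: "split_block A' 1 1 = (A1, A2, A0, A3)"
    by (cases "split_block A' 1 1") auto
  have dims: "dim_row A' = 1 + n" "dim_col A' = 1 + n" using A' by auto
  note blocks = split_block[OF split dims]
  have colA': "A' $$ (i, 0) = (if i = 0 then e else 0)" if "i < Suc n" for i
    using arg_cong[OF col0, of "\<lambda>v. v $ i"] that A' by (auto simp: A'_def[symmetric])
  have A0: "A0 = 0\<^sub>m n 1"
    using split[unfolded split_block_def Let_def] A' colA' by auto
  obtain B P Q where sim: "similar_mat_wit A3 B P Q" and ut: "upper_triangular B"
    and isoP: "\<forall>v \<in> carrier_vec n. euclid_norm (P *\<^sub>v v) = euclid_norm v"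
    using Suc.IH blocks(4) by blast
  note S = similar_mat_witD2[OF blocks(4) sim]
  define P1 where "P1 = four_block_mat (1\<^sub>m 1) (0\<^sub>m 1 n) (0\<^sub>m n 1) P"
  define Q1 where "Q1 = four_block_mat (1\<^sub>m 1) (0\<^sub>m 1 n) (0\<^sub>m n 1) Q"
  define C where "C = four_block_mat A1 (A2 * P) A0 B"
  have A2: "A2 = 1\<^sub>m 1 * (A2 * P) * Q"
    using blocks(2) S by (simp add: assoc_mult_mat[of _ 1 n _ n _ n])
  have "A0 = P * A0 * 1\<^sub>m 1" unfolding A0 using S by simp
  then have sim': "similar_mat_wit A' C P1 Q1"
    unfolding blocks(5) C_def P1_def Q1_def
    by (intro similar_mat_wit_four_block[OF similar_mat_wit_refl[OF blocks(1)] sim A2 _ blocks(1) blocks(4)])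
      (use blocks S in auto)
  have "upper_triangular C"
    unfolding C_def A0 by (rule upper_triangular_four_block[OF blocks(1) S(5) _ ut]) (use blocks in auto)
  moreover have "euclid_norm ((W * P1) *\<^sub>v v) = euclid_norm v" if v: "v \<in> carrier_vec (Suc n)" for v
  proof -
    define a d where "a = vec_first v 1" and "d = vec_last v n"
    have ad: "a \<in> carrier_vec 1" "d \<in> carrier_vec n" "v = a @\<^sub>v d"
      using v by (auto simp: a_def d_def)
    have P1: "P1 \<in> carrier_mat (Suc n) (Suc n)"
      unfolding P1_def using four_block_carrier_mat[OF one_carrier_mat[of 1] S(6)] by simp
    have "P1 *\<^sub>v v = a @\<^sub>v (P *\<^sub>v d)"
      unfolding P1_def ad(3) using mult_mat_vec_split[OF one_carrier_mat S(6) ad(1,2)] ad by simp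
    then have "(euclid_norm (P1 *\<^sub>v v))\<^sup>2 = (euclid_norm v)\<^sup>2"
      using isoP ad S(6) euclid_norm_append[OF ad(1,2)] euclid_norm_append[OF ad(1), of "P *\<^sub>v d" n] by simp
    then have "euclid_norm (P1 *\<^sub>v v) = euclid_norm v" by (simp add: power2_eq_iff_nonneg)
    then show ?thesis using W P1 v by (simp add: iso)
  qed
  ultimately show ?case using similar_mat_wit_trans[OF simA sim'] by blast
qed

section \<open>Norm bound for accretive matrices\<close>

text \<open>This bounds the triangular matrix with 1 on the diagonal and 2 above it. The Wirtinger
  inequality is applied to \<open>s k\<close>, the sum of the last \<open>k\<close> entries of
  \<open>y\<close>: differences of neighbours recover the entries, and sums of neighbours are the
  rows of that matrix applied to \<open>y\<close>, both in reverse order.\<close>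

lemma sum_square_tails_le_cot:
  fixes y :: "nat \<Rightarrow> real"
  assumes n: "0 < n"
  shows "(\<Sum>i<n. (y i + 2 * sum y {Suc i..<n})\<^sup>2) \<le> (cot (pi / (4 * real n)))\<^sup>2 * (\<Sum>i<n. (y i)\<^sup>2)"
proof -
  define s where "s k = sum y {n - k..<n}" for k
  have step: "s (n - Suc i) = sum y {Suc i..<n}" "s (Suc (n - Suc i)) = y i + sum y {Suc i..<n}" if "i < n" for i
    using that by (auto simp: s_def Suc_diff_Suc sum.atLeast_Suc_lessThan)
  have "(\<Sum>i<n. (y i + 2 * sum y {Suc i..<n})\<^sup>2) = (\<Sum>i<n. (s (n - Suc i) + s (Suc (n - Suc i)))\<^sup>2)"
    by (intro sum.cong refl) (simp add: step add_ac)
  also have "\<dots> = (\<Sum>i<n. (s i + s (Suc i))\<^sup>2)"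
    by (rule sum.nat_diff_reindex)
  also have "\<dots> \<le> (cot (pi / (4 * real n)))\<^sup>2 * (\<Sum>i<n. (s (Suc i) - s i)\<^sup>2)"
    by (rule discrete_wirtinger[OF n]) (simp add: s_def)
  also have "(\<Sum>i<n. (s (Suc i) - s i)\<^sup>2) = (\<Sum>i<n. (s (Suc (n - Suc i)) - s (n - Suc i))\<^sup>2)"
    by (rule sum.nat_diff_reindex[symmetric])
  also have "\<dots> = (\<Sum>i<n. (y i)\<^sup>2)"
    by (intro sum.cong refl) (simp add: step)
  finally show ?thesis .
qed

lemma eigenvalue_upper_triangular_iff:
  fixes A :: "'a :: field mat"
  assumes A: "A \<in> carrier_mat n n" and ut: "upper_triangular A"
  shows "eigenvalue A a \<longleftrightarrow> (\<exists>i<n. a = A $$ (i, i))"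
  unfolding eigenvalue_root_char_poly[OF A] char_poly_upper_triangular[OF A ut]
  using A by (auto simp: poly_prod_list prod_list_zero_iff diag_mat_def)

lemma cot_nonneg:
  assumes "0 < n"
  shows "0 \<le> cot (pi / (4 * real n))"
proof -
  have "pi / (4 * real n) \<le> pi / 2" using assms by (simp add: field_simps)
  moreover have "0 \<le> pi / (4 * real n)" by simp
  ultimately show ?thesis
    unfolding cot_def using pi_ge_zero
    by (intro divide_nonneg_nonneg cos_ge_zero sin_ge_zero; linarith)
qed

text \<open>Once the entries above the diagonal are bounded, the triangle inequality dominates each
  coordinate of \<open>B x\<close> by a row of the triangular matrix with entries \<open>K\<close>
  and \<open>2 * K\<close>, applied to the moduli of \<open>x\<close>.\<close>

lemma accretive_upper_triangular_bound:
  assumes B: "B \<in> carrier_mat n n" and ut: "upper_triangular B" and n: "0 < n" and x: "x \<in> carrier_vec n"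
    and accr: "\<And>v. v \<in> carrier_vec n \<Longrightarrow> euclid_norm (B *\<^sub>v v - v) \<le> euclid_norm (B *\<^sub>v v + v)"
    and diag: "\<And>i. i < n \<Longrightarrow> cmod (B $$ (i, i)) \<le> K" and K: "0 \<le> K"
  shows "euclid_norm (B *\<^sub>v x) \<le> K * cot (pi / (4 * real n)) * euclid_norm x"
proof -
  \<comment> \<open>Testing accretivity on \<open>e\<^sub>i + c e\<^sub>j\<close> with \<open>\<bar>c\<bar> = 1\<close> and \<open>c B\<^sub>i\<^sub>j = - \<bar>B\<^sub>i\<^sub>j\<bar>\<close>.\<close>
  have off: "cmod (B $$ (i, j)) \<le> 2 * K" if ij: "i < j" "j < n" for i j
  proof -
    \<comment> \<open>Since \<open>sgn 0 = 0\<close>, the zero case needs its own value to keep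
      \<open>c\<close> of modulus 1.\<close>
    define c where "c = (if B $$ (i, j) = 0 then 1 else - cnj (sgn (B $$ (i, j))))"
    have c: "cmod c = 1" by (simp add: c_def norm_sgn)
    have cB: "B $$ (i, j) * c = - complex_of_real (cmod (B $$ (i, j)))"
      using complex_norm_square[of "B $$ (i, j)"]
      by (auto simp: c_def sgn_eq power2_eq_square field_simps)
    define v where "v = vec n (\<lambda>k. if k = i then 1 else if k = j then c else 0)"
    have v: "v \<in> carrier_vec n" by (simp add: v_def)
    have vk: "v $ k = (if k = i then 1 else if k = j then c else 0)" if "k < n" for k
      using that by (simp add: v_def)
    have Bv: "(B *\<^sub>v v) $ k = B $$ (k, i) + B $$ (k, j) * c" if "k < n" for k
    proof -
      have "(B *\<^sub>v v) $ k = (\<Sum>l<n. (if l = i then B $$ (k, l) else 0) + (if l = j then B $$ (k, l) * c else 0))"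
        unfolding mult_mat_vec_nth[OF B v that] using ij by (intro sum.cong) (auto simp: vk)
      then show ?thesis using ij by (simp add: sum.distrib)
    qed
    have "0 \<le> (\<Sum>k<n. Re ((B *\<^sub>v v) $ k * cnj (v $ k)))"
      using accr[OF v] euclid_norm_diff_le_add_iff[of "B *\<^sub>v v" n v] B v by simp
    also have "\<dots> = (\<Sum>k<n. (if k = i then Re (B $$ (i, i) + B $$ (i, j) * c) else 0)
        + (if k = j then Re ((B $$ (j, i) + B $$ (j, j) * c) * cnj c) else 0))"
      using ij by (intro sum.cong) (auto simp: Bv vk simp del: index_mult_mat_vec)
    also have "\<dots> = Re (B $$ (i, i) + B $$ (i, j) * c) + Re ((B $$ (j, i) + B $$ (j, j) * c) * cnj c)"
      using ij by (simp add: sum.distrib)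
    \<comment> \<open>Triangularity removes the entry at \<open>(j, i)\<close>. What is left says
      that the modulus of the entry at \<open>(i, j)\<close> is at most the sum of the real parts of
      the two diagonal entries.\<close>
    also have "\<dots> = Re (B $$ (i, i) + B $$ (i, j) * c) + Re (B $$ (j, j) * (c * cnj c))"
      using upper_triangularD[OF ut, of i j] B ij by (simp only: carrier_matD add_0 mult.assoc)
    also have "c * cnj c = 1" using c complex_norm_square[of c] by simp
    finally have "cmod (B $$ (i, j)) \<le> Re (B $$ (i, i)) + Re (B $$ (j, j))"
      by (simp add: cB)
    then show ?thesis
      using diag[of i] diag[of j] complex_Re_le_cmod[of "B $$ (i, i)"] complex_Re_le_cmod[of "B $$ (j, j)"] ij
      by linarith
  qed
  define y where "y i = cmod (x $ i)" for i
  have row: "cmod ((B *\<^sub>v x) $ i) \<le> K * (y i + 2 * sum y {Suc i..<n})" if i: "i < n" for i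
  proof -
    have "cmod ((B *\<^sub>v x) $ i) \<le> (\<Sum>j<n. cmod (B $$ (i, j)) * y j)"
      using mult_mat_vec_nth[OF B x i] norm_sum[of "\<lambda>j. B $$ (i, j) * x $ j" "{..<n}"]
      by (simp add: norm_mult y_def)
    also have "\<dots> \<le> (\<Sum>j<n. (if j = i then K * y j else 0) + (if j \<in> {Suc i..<n} then 2 * K * y j else 0))"
    proof (intro sum_mono)
      fix j assume "j \<in> {..<n}"
      then show "cmod (B $$ (i, j)) * y j
          \<le> (if j = i then K * y j else 0) + (if j \<in> {Suc i..<n} then 2 * K * y j else 0)"
        using diag[OF i] off[of i j] upper_triangularD[OF ut, of j i] B i
        by (cases j i rule: linorder_cases) (auto simp: y_def intro!: mult_right_mono)
    qed
    also have "\<dots> = K * y i + (\<Sum>j \<in> {Suc i..<n}. 2 * K * y j)"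
      using i by (simp add: sum.distrib sum.inter_restrict[symmetric] del: atLeastLessThan_iff)
        (auto intro!: sum.cong)
    finally show ?thesis by (simp add: algebra_simps sum_distrib_left)
  qed
  have "(euclid_norm (B *\<^sub>v x))\<^sup>2 \<le> (\<Sum>i<n. (K * (y i + 2 * sum y {Suc i..<n}))\<^sup>2)"
    using B row by (auto simp: euclid_norm_square simp del: index_mult_mat_vec intro!: sum_mono power_mono)
  also have "\<dots> \<le> K\<^sup>2 * ((cot (pi / (4 * real n)))\<^sup>2 * (\<Sum>i<n. (y i)\<^sup>2))"
    unfolding power_mult_distrib sum_distrib_left[symmetric]
    by (intro mult_left_mono sum_square_tails_le_cot n) auto
  also have "\<dots> = (K * cot (pi / (4 * real n)) * euclid_norm x)\<^sup>2"
    using x by (simp add: power_mult_distrib euclid_norm_square y_def)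
  finally show ?thesis
    by (rule power2_le_imp_le) (use K cot_nonneg[OF n] in simp)
qed

text \<open>In the Schur form \<open>A P = P B\<close> with \<open>P\<close> isometric, so
  \<open>B\<close> inherits the norm form of accretivity from \<open>A\<close>. By similarity its
  diagonal consists of eigenvalues of \<open>A\<close>, and the bound for \<open>B\<close> at
  \<open>Q x\<close> is the bound for \<open>A\<close> at \<open>x\<close>.\<close>

lemma accretive_bound:
  assumes A: "A \<in> carrier_mat n n" and n: "0 < n" and x: "x \<in> carrier_vec n"
    and accr: "\<And>v. v \<in> carrier_vec n \<Longrightarrow> euclid_norm (A *\<^sub>v v - v) \<le> euclid_norm (A *\<^sub>v v + v)"
    and ev: "\<And>a. eigenvalue A a \<Longrightarrow> cmod a \<le> K" and K: "0 \<le> K"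
  shows "euclid_norm (A *\<^sub>v x) \<le> K * cot (pi / (4 * real n)) * euclid_norm x"
proof -
  obtain B P Q where sim: "similar_mat_wit A B P Q" and ut: "upper_triangular B"
    and isoP: "\<And>v. v \<in> carrier_vec n \<Longrightarrow> euclid_norm (P *\<^sub>v v) = euclid_norm v"
    using unitary_schur_decomposition[OF A] by blast
  note S = similar_mat_witD2[OF A sim]
  have PB: "A *\<^sub>v (P *\<^sub>v v) = P *\<^sub>v (B *\<^sub>v v)" if v: "v \<in> carrier_vec n" for v
  proof -
    have "A * P = P * B * (Q * P)"
      unfolding S(3) using S by (simp add: assoc_mult_mat[of _ n n _ n _ n])
    then have "A * P = P * B" using S by simp
    then show ?thesis using S v by (metis assoc_mult_mat_vec)
  qed
  have "euclid_norm (B *\<^sub>v (Q *\<^sub>v x)) \<le> K * cot (pi / (4 * real n)) * euclid_norm (Q *\<^sub>v x)"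
  proof (rule accretive_upper_triangular_bound[OF S(5) ut n _ _ _ K])
    show "Q *\<^sub>v x \<in> carrier_vec n" using S x by simp
  next
    fix v :: "complex vec" assume v: "v \<in> carrier_vec n"
    have Bv: "B *\<^sub>v v \<in> carrier_vec n" and Pv: "P *\<^sub>v v \<in> carrier_vec n" using S v by simp_all
    have "euclid_norm (P *\<^sub>v (B *\<^sub>v v - v)) \<le> euclid_norm (P *\<^sub>v (B *\<^sub>v v + v))"
      using accr[OF Pv] unfolding PB[OF v]
      by (simp add: mult_add_distrib_mat_vec[OF S(6) Bv v] mult_minus_distrib_mat_vec[OF S(6) Bv v])
    then show "euclid_norm (B *\<^sub>v v - v) \<le> euclid_norm (B *\<^sub>v v + v)"
      using Bv v by (simp add: isoP)
  next
    fix i assume "i < n"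
    then have "eigenvalue B (B $$ (i, i))"
      using eigenvalue_upper_triangular_iff[OF S(5) ut] by blast
    moreover have "similar_mat A B" using sim unfolding similar_mat_def by blast
    ultimately have "eigenvalue A (B $$ (i, i))"
      using char_poly_similar[of A B]
      by (simp add: eigenvalue_root_char_poly[OF A] eigenvalue_root_char_poly[OF S(5)])
    then show "cmod (B $$ (i, i)) \<le> K" by (rule ev)
  qed
  moreover have Px: "P *\<^sub>v (Q *\<^sub>v x) = x"
    using S x by (metis assoc_mult_mat_vec one_mult_mat_vec)
  moreover have "euclid_norm (Q *\<^sub>v x) = euclid_norm x"
    using isoP[of "Q *\<^sub>v x"] S x Px by simp
  moreover have "euclid_norm (B *\<^sub>v (Q *\<^sub>v x)) = euclid_norm (A *\<^sub>v x)"
    using isoP[of "B *\<^sub>v (Q *\<^sub>v x)"] PB[of "Q *\<^sub>v x"] S x Px by simp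
  ultimately show ?thesis by simp
qed

section \<open>Upper bound for the resolvent by the Cayley transform\<close>

text \<open>This evaluates the \<open>the (mat_inverse ...)\<close> in \<open>resolvent\<close>: a
  right inverse makes the determinant nonzero, which excludes \<open>None\<close>, and inverses are
  unique.\<close>

lemma mat_inverse_eqI:
  fixes A :: "'a :: field mat"
  assumes A: "A \<in> carrier_mat n n" and B: "B \<in> carrier_mat n n" and AB: "A * B = 1\<^sub>m n"
  shows "mat_inverse A = Some B"
proof (cases "mat_inverse A")
  case None
  have "det A * det B = 1" using det_mult[OF A B] AB by simp
  then have "det A \<noteq> 0" by auto
  then show ?thesis using mat_inverse(1)[OF A None, of "()"] det_non_zero_imp_unit[OF A, of "()"] by blast
next
  case (Some C)
  note C = mat_inverse(2)[OF A Some]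
  have "C = C * (A * B)" using AB C right_mult_one_mat[of C n n] by simp
  also have "\<dots> = (C * A) * B" using A B C by (intro assoc_mult_mat[symmetric]) auto
  also have "\<dots> = B" using B C by simp
  finally show ?thesis using Some by simp
qed

lemma det_nonzero_obtain_inverse:
  fixes A :: "'a :: field mat"
  assumes A: "A \<in> carrier_mat n n" and "det A \<noteq> 0"
  obtains B where "B \<in> carrier_mat n n" "A * B = 1\<^sub>m n" "B * A = 1\<^sub>m n"
  using det_non_zero_imp_unit[OF assms] by (auto simp: Units_def ring_mat_def)

text \<open>The hypothesis describes an Apollonius disc with diameter from (1 - r) / (1 + r) to (1 +
  r) / (1 - r) on the real axis; the right end is its point farthest from the origin.\<close>

lemma cmod_le_of_cayley:
  assumes r: "0 \<le> r" "r < 1" and "cmod (a - 1) \<le> r * cmod (a + 1)"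
  shows "cmod a \<le> (1 + r) / (1 - r)"
proof -
  have "cmod a - 1 \<le> cmod (a - 1)" using norm_triangle_ineq2[of a 1] by simp
  also have "\<dots> \<le> r * cmod (a + 1)" by fact
  also have "\<dots> \<le> r * (cmod a + 1)"
    using r norm_triangle_ineq[of a 1] by (intro mult_left_mono) auto
  finally have "cmod a * (1 - r) \<le> 1 + r" by (simp add: algebra_simps)
  then show ?thesis using r by (simp add: pos_le_divide_eq)
qed

text \<open>For \<open>A = 2 \<zeta> R - 1\<close> one has \<open>A + 1 = 2 \<zeta> R\<close> and
  \<open>A - 1 = 2 T R\<close>. Comparing the two, contractivity of \<open>T\<close> gives
  accretivity of \<open>A\<close>, and the first identity bounds the norm of \<open>R\<close> by
  half of 1 plus the norm of \<open>A\<close>.\<close>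

lemma op_norm_resolvent_le:
  assumes T: "T \<in> contractions n" and rho: "spectral_radius T \<le> r" and r: "0 \<le> r" "r < 1"
    and \<zeta>: "cmod \<zeta> = 1" and n: "0 < n"
  shows "op_norm (resolvent \<zeta> T) \<le> (1 + (1 + r) / (1 - r) * cot (pi / (4 * real n))) / 2"
proof -
  define K where "K = (1 + r) / (1 - r)"
  have K: "0 \<le> K" using r by (simp add: K_def)
  have T': "T \<in> carrier_mat n n" "op_norm T \<le> 1" using T by (auto simp: contractions_def)
  have ev: "cmod a \<le> r" if "eigenvalue T a" for a
    using spectral_radius_mem_max(2)[OF T'(1) n, of "cmod a"] that rho by (auto simp: spectrum_def)
  have contr: "euclid_norm (T *\<^sub>v v) \<le> euclid_norm v" if "v \<in> carrier_vec n" for v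
    using euclid_norm_mult_le_op_norm[OF T'(1) that] T'(2) mult_right_mono[OF T'(2), of "euclid_norm v"] by simp
  define M where "M = \<zeta> \<cdot>\<^sub>m 1\<^sub>m n - T"
  have M: "M \<in> carrier_mat n n" unfolding M_def by (rule minus_carrier_mat[OF T'(1)])
  have Mv: "M *\<^sub>v v = \<zeta> \<cdot>\<^sub>v v - T *\<^sub>v v" if "v \<in> carrier_vec n" for v
    unfolding M_def using that T'
    by (subst minus_mult_distrib_mat_vec[of _ n n]) (auto intro!: eq_vecI)
  have "det M \<noteq> 0"
  proof
    assume "det M = 0"
    then obtain v where v: "v \<in> carrier_vec n" "v \<noteq> 0\<^sub>v n" "M *\<^sub>v v = 0\<^sub>v n"
      using det_0_iff_vec_prod_zero_field[OF M] by blast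
    have "T *\<^sub>v v = \<zeta> \<cdot>\<^sub>v v"
    proof (intro eq_vecI)
      fix i assume "i < dim_vec (\<zeta> \<cdot>\<^sub>v v)"
      then show "(T *\<^sub>v v) $ i = (\<zeta> \<cdot>\<^sub>v v) $ i"
        using arg_cong[OF v(3)[unfolded Mv[OF v(1)]], of "\<lambda>u. u $ i"] v(1) T' by simp
    qed (use T' v in auto)
    then have "eigenvalue T \<zeta>" using v T' by (auto simp: eigenvalue_def eigenvector_def)
    then show False using ev \<zeta> r by fastforce
  qed
  then obtain R where R: "R \<in> carrier_mat n n" "M * R = 1\<^sub>m n" "R * M = 1\<^sub>m n"
    using det_nonzero_obtain_inverse[OF M] by blast
  have res: "resolvent \<zeta> T = R"
    unfolding resolvent_def using mat_inverse_eqI[OF M R(1,2)] T' by (simp add: M_def)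
  have MR: "M *\<^sub>v (R *\<^sub>v v) = v" if "v \<in> carrier_vec n" for v
    using R M that by (metis assoc_mult_mat_vec one_mult_mat_vec)
  \<comment> \<open>The Cayley transform of \<open>T\<close>; contractivity of \<open>T\<close> makes it accretive.\<close>
  define A where "A = (2 * \<zeta>) \<cdot>\<^sub>m R - 1\<^sub>m n"
  have A: "A \<in> carrier_mat n n" unfolding A_def by (rule minus_carrier_mat) simp
  have Av: "A *\<^sub>v v = (2 * \<zeta>) \<cdot>\<^sub>v (R *\<^sub>v v) - v" if "v \<in> carrier_vec n" for v
    unfolding A_def using that R
    by (subst minus_mult_distrib_mat_vec[of _ n n]) (auto intro!: eq_vecI)
  have plus: "A *\<^sub>v v + v = (2 * \<zeta>) \<cdot>\<^sub>v (R *\<^sub>v v)" if "v \<in> carrier_vec n" for v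
    unfolding Av[OF that] using that R by (intro eq_vecI) auto
  have minus: "A *\<^sub>v v - v = 2 \<cdot>\<^sub>v (T *\<^sub>v (R *\<^sub>v v))" if v: "v \<in> carrier_vec n" for v
  proof (intro eq_vecI)
    have Rv: "R *\<^sub>v v \<in> carrier_vec n" using R v by simp
    fix i assume "i < dim_vec (2 \<cdot>\<^sub>v (T *\<^sub>v (R *\<^sub>v v)))"
    then have i: "i < n" using T' by simp
    have "v $ i = \<zeta> * (R *\<^sub>v v) $ i - (T *\<^sub>v (R *\<^sub>v v)) $ i"
      using arg_cong[OF MR[OF v, unfolded Mv[OF Rv]], of "\<lambda>u. u $ i"] i T' R v
      by (simp del: index_mult_mat_vec)
    then show "(A *\<^sub>v v - v) $ i = (2 \<cdot>\<^sub>v (T *\<^sub>v (R *\<^sub>v v))) $ i"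
      unfolding Av[OF v] using i v T' R by (simp del: index_mult_mat_vec)
  qed (use T' A v in auto)
  have bound: "euclid_norm (A *\<^sub>v v) \<le> K * cot (pi / (4 * real n)) * euclid_norm v"
    if "v \<in> carrier_vec n" for v
  proof (rule accretive_bound[OF A n that])
    fix v :: "complex vec" assume v: "v \<in> carrier_vec n"
    have "euclid_norm (A *\<^sub>v v - v) = 2 * euclid_norm (T *\<^sub>v (R *\<^sub>v v))"
      by (simp add: minus[OF v] euclid_norm_smult)
    also have "\<dots> \<le> 2 * euclid_norm (R *\<^sub>v v)" using contr R v by simp
    also have "\<dots> = euclid_norm (A *\<^sub>v v + v)"
      by (simp add: plus[OF v] euclid_norm_smult norm_mult \<zeta>)
    finally show "euclid_norm (A *\<^sub>v v - v) \<le> euclid_norm (A *\<^sub>v v + v)" .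
  next
    fix a assume "eigenvalue A a"
    then obtain v where v: "v \<in> carrier_vec n" "v \<noteq> 0\<^sub>v n" "A *\<^sub>v v = a \<cdot>\<^sub>v v"
      using A by (auto simp: eigenvalue_def eigenvector_def)
    define w where "w = R *\<^sub>v v"
    have w: "w \<in> carrier_vec n" using R v by (simp add: w_def)
    have w0: "w \<noteq> 0\<^sub>v n"
    proof
      assume "w = 0\<^sub>v n"
      then have "M *\<^sub>v w = 0\<^sub>v n" using M by (intro eq_vecI) auto
      then show False using MR[OF v(1)] v(2) by (simp add: w_def)
    qed
    \<comment> \<open>These are the coordinates of \<open>(A + 1) v\<close> and
      \<open>(A - 1) v\<close> for the eigenvector \<open>v\<close>. Eliminating \<open>v\<close>
      shows that \<open>w = R v\<close> is an eigenvector of \<open>T\<close> for the inverse Cayley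
      image of \<open>a\<close>; the value -1 is excluded since it would force \<open>w\<close> to
      vanish.\<close>
    have p: "(a + 1) * v $ i = 2 * \<zeta> * w $ i" and m: "(a - 1) * v $ i = 2 * (T *\<^sub>v w) $ i" if "i < n" for i
      using arg_cong[OF plus[OF v(1)], of "\<lambda>u. u $ i"] arg_cong[OF minus[OF v(1)], of "\<lambda>u. u $ i"]
        v w T' that unfolding v(3) w_def[symmetric]
      by (simp_all add: algebra_simps del: index_mult_mat_vec)
    have a1: "a + 1 \<noteq> 0"
    proof
      assume "a + 1 = 0"
      then have "w $ i = 0" if "i < n" for i using p[OF that] \<zeta> by auto
      then have "w = 0\<^sub>v n" using w by (intro eq_vecI) auto
      with w0 show False ..
    qed
    have "T *\<^sub>v w = ((a - 1) * \<zeta> / (a + 1)) \<cdot>\<^sub>v w"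
    proof (intro eq_vecI)
      fix i assume "i < dim_vec (((a - 1) * \<zeta> / (a + 1)) \<cdot>\<^sub>v w)"
      then have i: "i < n" using w by simp
      have "2 * ((a + 1) * (T *\<^sub>v w) $ i) = (a + 1) * ((a - 1) * v $ i)"
        unfolding m[OF i] by (simp only: mult_ac)
      also have "\<dots> = (a - 1) * ((a + 1) * v $ i)" by (simp only: mult_ac)
      also have "\<dots> = 2 * ((a - 1) * \<zeta> * w $ i)" unfolding p[OF i] by (simp only: mult_ac)
      finally have "(a + 1) * (T *\<^sub>v w) $ i = (a - 1) * \<zeta> * w $ i"
        by (metis mult_cancel_left zero_neq_numeral)
      then have "(T *\<^sub>v w) $ i = (a - 1) * \<zeta> * w $ i / (a + 1)"
        using a1 by (metis nonzero_mult_div_cancel_left)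
      then show "(T *\<^sub>v w) $ i = (((a - 1) * \<zeta> / (a + 1)) \<cdot>\<^sub>v w) $ i"
        using i w by (simp del: index_mult_mat_vec)
    qed (use T' w in auto)
    then have "eigenvalue T ((a - 1) * \<zeta> / (a + 1))"
      using w w0 T' by (auto simp: eigenvalue_def eigenvector_def)
    from ev[OF this] have "cmod (a - 1) / cmod (a + 1) \<le> r"
      by (simp only: norm_mult norm_divide \<zeta> mult_1_right)
    then have "cmod (a - 1) \<le> r * cmod (a + 1)"
      using a1 pos_divide_le_eq[of "cmod (a + 1)" "cmod (a - 1)" r] zero_less_norm_iff[of "a + 1"] by blast
    then show "cmod a \<le> K" unfolding K_def by (rule cmod_le_of_cayley[OF r])
  qed (rule K)
  show ?thesis unfolding res K_def[symmetric]
  proof (rule op_norm_le[OF R(1)])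
    show "0 \<le> (1 + K * cot (pi / (4 * real n))) / 2"
      using K cot_nonneg[OF n] by simp
  next
    fix v :: "complex vec" assume v: "v \<in> carrier_vec n"
    have "2 * euclid_norm (R *\<^sub>v v) = euclid_norm (A *\<^sub>v v + v)"
      by (simp add: plus[OF v] euclid_norm_smult norm_mult \<zeta>)
    also have "\<dots> \<le> euclid_norm (A *\<^sub>v v) + euclid_norm v"
      using A v by (intro euclid_norm_add_le) auto
    also have "\<dots> \<le> (1 + K * cot (pi / (4 * real n))) * euclid_norm v"
      using bound[OF v] by (simp add: algebra_simps)
    finally show "euclid_norm (R *\<^sub>v v)
        \<le> (1 + K * cot (pi / (4 * real n))) / 2 * euclid_norm v"
      by (simp add: field_simps)
  qed
qed

section \<open>The extremal matrix and the lower bound\<close>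

text \<open>For \<open>K \<ge> 0\<close> every entry on and above the diagonal attains the bound
  found in \<open>accretive_upper_triangular_bound\<close>, and all entries are nonnegative, so
  nothing cancels on nonnegative vectors.\<close>

definition extremal_mat :: "real \<Rightarrow> nat \<Rightarrow> complex mat" where
  "extremal_mat K n = mat n n (\<lambda>(i, j). complex_of_real (if i < j then 2 * K else if i = j then K else 0))"

lemma extremal_mat_carrier [simp]: "extremal_mat K n \<in> carrier_mat n n"
  by (simp add: extremal_mat_def)

text \<open>Two consecutive tail sums are used because an entry of \<open>v\<close> is their
  difference; both the accretivity of the matrix and its extremal vector are read off from this
  form.\<close>

lemma extremal_mat_mult_nth:
  assumes v: "v \<in> carrier_vec n" and i: "i < n"
  shows "(extremal_mat K n *\<^sub>v v) $ i = K * ((\<Sum>j=i..<n. v $ j) + (\<Sum>j=Suc i..<n. v $ j))"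
proof -
  have "(extremal_mat K n *\<^sub>v v) $ i
      = (\<Sum>j<n. (if j = i then K * v $ j else 0) + (if j \<in> {Suc i..<n} then 2 * K * v $ j else 0))"
    unfolding mult_mat_vec_nth[OF extremal_mat_carrier v i]
    using i by (intro sum.cong) (auto simp: extremal_mat_def)
  also have "\<dots> = K * v $ i + (\<Sum>j \<in> {Suc i..<n}. 2 * K * v $ j)"
    using i by (simp add: sum.distrib sum.inter_restrict[symmetric] del: atLeastLessThan_iff)
      (auto intro!: sum.cong)
  finally show ?thesis
    using i by (simp add: sum.atLeast_Suc_lessThan algebra_simps sum_distrib_left)
qed

text \<open>With tail sums S, coordinate i of the product is K (S_i + S_(i+1)), while
  \<open>v $ i\<close> is S_i - S_(i+1). The real part of their Hermitian product is a difference of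
  squared moduli, and the sum telescopes to K |S_0|^2.\<close>

lemma extremal_mat_accretive:
  assumes v: "v \<in> carrier_vec n" and "0 \<le> K"
  shows "euclid_norm (extremal_mat K n *\<^sub>v v - v) \<le> euclid_norm (extremal_mat K n *\<^sub>v v + v)"
proof -
  define S where "S i = (\<Sum>j=i..<n. v $ j)" for i
  have "(\<Sum>i<n. Re ((extremal_mat K n *\<^sub>v v) $ i * cnj (v $ i)))
      = (\<Sum>i<n. K * (cmod (S i))\<^sup>2 - K * (cmod (S (Suc i)))\<^sup>2)"
  proof (intro sum.cong refl)
    fix i assume "i \<in> {..<n}"
    then have i: "i < n" by simp
    have vi: "v $ i = S i - S (Suc i)" using i by (simp add: S_def sum.atLeast_Suc_lessThan)
    show "Re ((extremal_mat K n *\<^sub>v v) $ i * cnj (v $ i)) = K * (cmod (S i))\<^sup>2 - K * (cmod (S (Suc i)))\<^sup>2"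
      unfolding extremal_mat_mult_nth[OF v i] S_def[symmetric] vi
      by (simp only: cmod_power2) (simp add: algebra_simps power2_eq_square)
  qed
  also have "\<dots> = K * (cmod (S 0))\<^sup>2"
    by (subst sum_lessThan_telescope') (simp add: S_def)
  also have "\<dots> \<ge> 0" using \<open>0 \<le> K\<close> by simp
  finally show ?thesis
    using v by (subst euclid_norm_diff_le_add_iff[of _ n])
      (auto intro!: mult_mat_vec_carrier[of _ n n])
qed

text \<open>The vector \<open>x\<close> consists of the increments of the extremal sine sequence in
  reverse order, so that its tail sums are the values of that sequence and the equality case of the
  Wirtinger inequality applies.\<close>

lemma extremal_mat_attains_cot:
  assumes n: "0 < n" and K: "0 \<le> K"
  obtains x where "x \<in> carrier_vec n" "0 < euclid_norm x"
    "euclid_norm (extremal_mat K n *\<^sub>v x) = K * cot (pi / (4 * real n)) * euclid_norm x"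
proof -
  define s where "s k = sin (real k * (pi / (2 * real n)))" for k
  define x where "x = vec n (\<lambda>i. complex_of_real (s (n - i) - s (n - Suc i)))"
  have x: "x \<in> carrier_vec n" by (simp add: x_def)
  have tail: "(\<Sum>j=k..<n. x $ j) = complex_of_real (s (n - k))" if "k \<le> n" for k
  proof -
    have "(\<Sum>j=k..<n. x $ j) = (\<Sum>j=k..<n. - complex_of_real (s (n - Suc j)) - - complex_of_real (s (n - j)))"
      by (intro sum.cong) (auto simp: x_def)
    also have "\<dots> = complex_of_real (s (n - k))"
      using sum_Suc_diff'[OF that, of "\<lambda>j. - complex_of_real (s (n - j))"] by (simp add: s_def)
    finally show ?thesis .
  qed
  have "(euclid_norm (extremal_mat K n *\<^sub>v x))\<^sup>2
      = (\<Sum>i<n. (cmod ((extremal_mat K n *\<^sub>v x) $ i))\<^sup>2)"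
    by (simp add: euclid_norm_square extremal_mat_def)
  also have "\<dots> = (\<Sum>i<n. K\<^sup>2 * (s (n - Suc i) + s (Suc (n - Suc i)))\<^sup>2)"
  proof (intro sum.cong refl)
    fix i assume "i \<in> {..<n}"
    then have i: "i < n" by simp
    have "(extremal_mat K n *\<^sub>v x) $ i = complex_of_real (K * (s (n - Suc i) + s (Suc (n - Suc i))))"
      using i by (simp add: extremal_mat_mult_nth[OF x] tail Suc_diff_Suc add.commute del: index_mult_mat_vec)
    then show "(cmod ((extremal_mat K n *\<^sub>v x) $ i))\<^sup>2 = K\<^sup>2 * (s (n - Suc i) + s (Suc (n - Suc i)))\<^sup>2"
      by (simp only: norm_of_real power2_abs power_mult_distrib)
  qed
  also have "\<dots> = K\<^sup>2 * (\<Sum>i<n. (s i + s (Suc i))\<^sup>2)"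
    unfolding sum_distrib_left[symmetric]
    by (subst sum.nat_diff_reindex[where g = "\<lambda>i. (s i + s (Suc i))\<^sup>2"]) simp
  also have "\<dots> = K\<^sup>2 * ((cot (pi / (4 * real n)))\<^sup>2 * (\<Sum>i<n. (s (Suc i) - s i)\<^sup>2))"
    unfolding s_def by (simp only: sin_steps_wirtinger_eq[OF n])
  also have norm_x: "(\<Sum>i<n. (s (Suc i) - s i)\<^sup>2) = (euclid_norm x)\<^sup>2"
  proof -
    have "(\<Sum>i<n. (s (Suc i) - s i)\<^sup>2) = (\<Sum>i<n. (s (Suc (n - Suc i)) - s (n - Suc i))\<^sup>2)"
      by (rule sum.nat_diff_reindex[symmetric])
    also have "\<dots> = (\<Sum>i<n. (cmod (x $ i))\<^sup>2)"
    proof (intro sum.cong refl)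
      fix i assume "i \<in> {..<n}"
      then have "x $ i = complex_of_real (s (Suc (n - Suc i)) - s (n - Suc i))"
        by (simp add: x_def Suc_diff_Suc)
      then show "(s (Suc (n - Suc i)) - s (n - Suc i))\<^sup>2 = (cmod (x $ i))\<^sup>2"
        by (simp only: norm_of_real power2_abs)
    qed
    finally show ?thesis by (simp add: euclid_norm_square x_def)
  qed
  finally have "(euclid_norm (extremal_mat K n *\<^sub>v x))\<^sup>2 = (K * cot (pi / (4 * real n)) * euclid_norm x)\<^sup>2"
    by (simp add: power_mult_distrib)
  then have eq: "euclid_norm (extremal_mat K n *\<^sub>v x) = K * cot (pi / (4 * real n)) * euclid_norm x"
    using K cot_nonneg[OF n] by (subst (asm) power2_eq_iff_nonneg) auto
  have "0 < sin (pi / (2 * real n))"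
    using n by (intro sin_gt_zero) (auto simp: field_simps)
  then have "0 < (s (Suc 0) - s 0)\<^sup>2" by (simp add: s_def)
  also have "\<dots> \<le> (\<Sum>i<n. (s (Suc i) - s i)\<^sup>2)"
    by (rule member_le_sum) (use n in auto)
  finally have "0 < euclid_norm x"
    unfolding norm_x using euclid_norm_nonneg[of x] by (simp add: less_le del: euclid_norm_nonneg)
  with x eq show thesis using that by blast
qed

text \<open>The matrix \<open>T = \<zeta> - 2 \<zeta> (1 + A)^(-1)\<close>, with \<open>A\<close>
  extremal, has resolvent \<open>(1 + A) / (2 \<zeta>)\<close>. The norm of this is at least half of
  the norm of \<open>A\<close> minus 1.\<close>

lemma extremal_resolvent:
  assumes r: "0 \<le> r" "r < 1" and \<zeta>: "cmod \<zeta> = 1" and n: "0 < n"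
  obtains T where "T \<in> contractions n" "spectral_radius T \<le> r"
    "((1 + r) / (1 - r) * cot (pi / (4 * real n)) - 1) / 2 \<le> op_norm (resolvent \<zeta> T)"
proof -
  define K where "K = (1 + r) / (1 - r)"
  have K: "0 \<le> K" using r by (simp add: K_def)
  \<comment> \<open>So (K - 1) / (K + 1) = r: the inverse Cayley transform sends the only eigenvalue
    \<open>K\<close> of the extremal matrix to a number of modulus exactly \<open>r\<close>.\<close>
  have Kr: "K - 1 = r * (K + 1)" using r by (simp add: K_def field_simps)
  define A where "A = extremal_mat K n"
  have A: "A \<in> carrier_mat n n" by (simp add: A_def)
  have ut: "upper_triangular A" by (auto simp: A_def extremal_mat_def)
  define N where "N = 1\<^sub>m n + A"
  have N: "N \<in> carrier_mat n n" using A by (simp add: N_def)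
  have Nv: "N *\<^sub>v v = v + A *\<^sub>v v" if "v \<in> carrier_vec n" for v
    unfolding N_def using add_mult_distrib_mat_vec[OF one_carrier_mat A that] that by simp
  have "upper_triangular N" by (auto simp: N_def A_def extremal_mat_def)
  moreover have "complex_of_real (1 + K) \<noteq> 0" using K by (simp only: of_real_eq_0_iff)
  then have "0 \<notin> set (diag_mat N)"
    using A by (auto simp: diag_mat_def N_def A_def extremal_mat_def)
  ultimately have "det N \<noteq> 0" using upper_triangular_imp_det_eq_0_iff[OF N] by simp
  then obtain W where W: "W \<in> carrier_mat n n" "N * W = 1\<^sub>m n" "W * N = 1\<^sub>m n"
    using det_nonzero_obtain_inverse[OF N] by blast
  have NW: "N *\<^sub>v (W *\<^sub>v v) = v" if "v \<in> carrier_vec n" for v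
    using N W that by (metis assoc_mult_mat_vec one_mult_mat_vec)
  \<comment> \<open>The contraction whose Cayley transform is \<open>A\<close>.\<close>
  define T where "T = \<zeta> \<cdot>\<^sub>m 1\<^sub>m n - (2 * \<zeta>) \<cdot>\<^sub>m W"
  have T: "T \<in> carrier_mat n n" unfolding T_def using W by (intro minus_carrier_mat) simp
  have Tv: "T *\<^sub>v w = \<zeta> \<cdot>\<^sub>v (A *\<^sub>v (W *\<^sub>v w) - W *\<^sub>v w)" if w: "w \<in> carrier_vec n" for w
  proof (intro eq_vecI)
    have Ww: "W *\<^sub>v w \<in> carrier_vec n" using W w by simp
    fix i assume "i < dim_vec (\<zeta> \<cdot>\<^sub>v (A *\<^sub>v (W *\<^sub>v w) - W *\<^sub>v w))"
    then have i: "i < n" using W by simp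
    have wi: "w $ i = (W *\<^sub>v w) $ i + (A *\<^sub>v (W *\<^sub>v w)) $ i"
      using arg_cong[OF NW[OF w, unfolded Nv[OF Ww]], of "\<lambda>u. u $ i"] i A W
      by (simp del: index_mult_mat_vec)
    have "T *\<^sub>v w = \<zeta> \<cdot>\<^sub>v w - (2 * \<zeta>) \<cdot>\<^sub>v (W *\<^sub>v w)"
      unfolding T_def using w W
      by (subst minus_mult_distrib_mat_vec[of _ n n]) (auto intro!: eq_vecI)
    then show "(T *\<^sub>v w) $ i = (\<zeta> \<cdot>\<^sub>v (A *\<^sub>v (W *\<^sub>v w) - W *\<^sub>v w)) $ i"
      using i w W A by (simp add: wi algebra_simps del: index_mult_mat_vec)
  qed (use T W in auto)
  have "op_norm T \<le> 1"
  proof (rule op_norm_le[OF T])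
    fix w :: "complex vec" assume w: "w \<in> carrier_vec n"
    define v where "v = W *\<^sub>v w"
    have v: "v \<in> carrier_vec n" using W w by (simp add: v_def)
    have "euclid_norm (T *\<^sub>v w) = euclid_norm (A *\<^sub>v v - v)"
      using \<zeta> by (simp add: Tv[OF w] v_def euclid_norm_smult)
    also have "\<dots> \<le> euclid_norm (A *\<^sub>v v + v)"
      unfolding A_def by (rule extremal_mat_accretive[OF v K])
    also have "A *\<^sub>v v + v = w"
      using NW[OF w] Nv[OF v] comm_add_vec[OF v, of "A *\<^sub>v v"] A v by (simp add: v_def)
    finally show "euclid_norm (T *\<^sub>v w) \<le> 1 * euclid_norm w" by simp
  qed simp
  then have contr: "T \<in> contractions n" using T by (simp add: contractions_def)
  \<comment> \<open>An eigenvalue of \<open>T\<close> is carried back to the eigenvalue (\<zeta> +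
    l) / (\<zeta> - l) of \<open>A\<close>, which must be the constant diagonal entry
    \<open>K\<close>.\<close>
  have "cmod l = r" if "eigenvalue T l" for l
  proof -
    obtain w where w: "w \<in> carrier_vec n" "w \<noteq> 0\<^sub>v n" "T *\<^sub>v w = l \<cdot>\<^sub>v w"
      using \<open>eigenvalue T l\<close> T by (auto simp: eigenvalue_def eigenvector_def)
    define v where "v = W *\<^sub>v w"
    have v: "v \<in> carrier_vec n" using W w by (simp add: v_def)
    have Nvw: "N *\<^sub>v v = w" using NW[OF w(1)] by (simp add: v_def)
    have v0: "v \<noteq> 0\<^sub>v n"
    proof
      assume "v = 0\<^sub>v n"
      then have "N *\<^sub>v v = 0\<^sub>v n" using N by (intro eq_vecI) auto
      with Nvw w show False by simp
    qed
    have eq: "(\<zeta> - l) * (A *\<^sub>v v) $ i = (\<zeta> + l) * v $ i" if "i < n" for i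
    proof -
      have "\<zeta> * ((A *\<^sub>v v) $ i - v $ i) = l * (v $ i + (A *\<^sub>v v) $ i)"
        using arg_cong[OF w(3)[unfolded Tv[OF w(1)] v_def[symmetric]], of "\<lambda>u. u $ i"]
          arg_cong[OF Nvw[unfolded Nv[OF v]], of "\<lambda>u. u $ i"] that A v w
        by (simp del: index_mult_mat_vec)
      then show ?thesis by (simp add: algebra_simps)
    qed
    have ne: "\<zeta> - l \<noteq> 0"
    proof
      assume "\<zeta> - l = 0"
      then have "v $ i = 0" if "i < n" for i using eq[OF that] \<zeta> by auto
      then have "v = 0\<^sub>v n" using v by (intro eq_vecI) auto
      with v0 show False ..
    qed
    have "A *\<^sub>v v = ((\<zeta> + l) / (\<zeta> - l)) \<cdot>\<^sub>v v"
      using eq ne A v by (intro eq_vecI) (auto simp: field_simps simp del: index_mult_mat_vec)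
    then have "eigenvalue A ((\<zeta> + l) / (\<zeta> - l))"
      using v v0 A by (auto simp: eigenvalue_def eigenvector_def)
    then have "(\<zeta> + l) / (\<zeta> - l) = K"
      using eigenvalue_upper_triangular_iff[OF A ut] by (auto simp: A_def extremal_mat_def)
    then have "l * complex_of_real (K + 1) = \<zeta> * complex_of_real (K - 1)"
      using ne by (simp add: field_simps)
    then have "cmod l * \<bar>K + 1\<bar> = \<bar>K - 1\<bar>"
      using \<zeta> by (metis mult_1 norm_mult norm_of_real)
    then show ?thesis using K r unfolding Kr by (simp add: abs_mult)
  qed
  then have rho: "spectral_radius T \<le> r"
    using spectral_radius_mem_max(1)[OF T n] by (auto simp: spectrum_def)
  have \<zeta>0: "\<zeta> \<noteq> 0" using \<zeta> by auto
  have "(\<zeta> \<cdot>\<^sub>m 1\<^sub>m n - T) * ((1 / (2 * \<zeta>)) \<cdot>\<^sub>m N) = 1\<^sub>m n"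
  proof -
    have "\<zeta> \<cdot>\<^sub>m 1\<^sub>m n - T = (2 * \<zeta>) \<cdot>\<^sub>m W"
      unfolding T_def using W by (intro eq_matI) auto
    also have "\<dots> * ((1 / (2 * \<zeta>)) \<cdot>\<^sub>m N) = (2 * \<zeta>) \<cdot>\<^sub>m (W * ((1 / (2 * \<zeta>)) \<cdot>\<^sub>m N))"
      by (rule mult_smult_assoc_mat[OF W(1) smult_carrier_mat[OF N]])
    also have "W * ((1 / (2 * \<zeta>)) \<cdot>\<^sub>m N) = (1 / (2 * \<zeta>)) \<cdot>\<^sub>m (W * N)"
      by (rule mult_smult_distrib[OF W(1) N])
    also have "(2 * \<zeta>) \<cdot>\<^sub>m ((1 / (2 * \<zeta>)) \<cdot>\<^sub>m (W * N)) = 1\<^sub>m n"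
      unfolding W(3) using \<zeta>0 by (intro eq_matI) auto
    finally show ?thesis .
  qed
  then have "mat_inverse (\<zeta> \<cdot>\<^sub>m 1\<^sub>m n - T) = Some ((1 / (2 * \<zeta>)) \<cdot>\<^sub>m N)"
    by (rule mat_inverse_eqI[OF minus_carrier_mat[OF T] smult_carrier_mat[OF N]])
  then have res: "resolvent \<zeta> T = (1 / (2 * \<zeta>)) \<cdot>\<^sub>m N"
    using T by (simp add: resolvent_def)
  obtain x where x: "x \<in> carrier_vec n" "0 < euclid_norm x"
    and Ax: "euclid_norm (A *\<^sub>v x) = K * cot (pi / (4 * real n)) * euclid_norm x"
    using extremal_mat_attains_cot[OF n K] unfolding A_def by blast
  have "euclid_norm (A *\<^sub>v x) = euclid_norm (N *\<^sub>v x + (-1) \<cdot>\<^sub>v x)"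
    unfolding Nv[OF x(1)] using x A by (intro arg_cong[of _ _ euclid_norm] eq_vecI) auto
  also have "\<dots> \<le> euclid_norm (N *\<^sub>v x) + euclid_norm x"
    using euclid_norm_add_le[of "N *\<^sub>v x" n "(-1) \<cdot>\<^sub>v x"] x N by (simp add: euclid_norm_smult)
  also have "euclid_norm (N *\<^sub>v x) = 2 * euclid_norm (resolvent \<zeta> T *\<^sub>v x)"
  proof -
    have "resolvent \<zeta> T *\<^sub>v x = (1 / (2 * \<zeta>)) \<cdot>\<^sub>v (N *\<^sub>v x)"
      unfolding res using N x by (intro eq_vecI) auto
    then show ?thesis using \<zeta> by (simp add: euclid_norm_smult norm_divide norm_mult)
  qed
  also have "euclid_norm (resolvent \<zeta> T *\<^sub>v x) \<le> op_norm (resolvent \<zeta> T) * euclid_norm x"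
    using x N res by (intro euclid_norm_mult_le_op_norm[of _ n n]) auto
  finally have "(K * cot (pi / (4 * real n)) - 1) * euclid_norm x \<le> 2 * op_norm (resolvent \<zeta> T) * euclid_norm x"
    unfolding Ax by (simp add: algebra_simps)
  then have "(K * cot (pi / (4 * real n)) - 1) / 2 \<le> op_norm (resolvent \<zeta> T)"
    using x by simp
  with contr rho show thesis using that by (simp add: K_def)
qed

section \<open>Two-sided bound for the supremum and its asymptotics\<close>

text \<open>The uniform upper bound also supplies boundedness, and the extremal matrix also supplies
  nonemptiness, so the real supremum is governed by both estimates.\<close>

lemma max_resolvent_bounds:
  assumes r: "0 \<le> r" "r < 1" and \<zeta>: "cmod \<zeta> = 1" and n: "0 < n"
  defines "C \<equiv> (1 + r) / (1 - r) * cot (pi / (4 * real n))"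
  shows "(C - 1) / 2 \<le> max_resolvent \<zeta> n r" and "max_resolvent \<zeta> n r \<le> (C + 1) / 2"
proof -
  have upper: "op_norm (resolvent \<zeta> T) \<le> (C + 1) / 2"
    if "T \<in> {T \<in> contractions n. spectral_radius T \<le> r}" for T
    using op_norm_resolvent_le[of T n r \<zeta>] that r \<zeta> n by (simp add: C_def add.commute)
  obtain T where T: "T \<in> {T \<in> contractions n. spectral_radius T \<le> r}"
    and lower: "(C - 1) / 2 \<le> op_norm (resolvent \<zeta> T)"
    using extremal_resolvent[OF r \<zeta> n] unfolding C_def by blast
  show "max_resolvent \<zeta> n r \<le> (C + 1) / 2"
    unfolding max_resolvent_def using T upper by (intro cSUP_least) blast+
  have "op_norm (resolvent \<zeta> T) \<le> max_resolvent \<zeta> n r"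
    unfolding max_resolvent_def using T upper by (intro cSUP_upper bdd_aboveI2)
  with lower show "(C - 1) / 2 \<le> max_resolvent \<zeta> n r" by linarith
qed

theorem theorem2:
  fixes r :: real and \<zeta> :: complex
  assumes "0 < r" and "r < 1" and "cmod \<zeta> = 1"
  shows "(\<lambda>n. max_resolvent \<zeta> n r) \<sim>[at_top] (\<lambda>n. 2 / pi * ((1 + r) / (1 - r)) * real n)"
proof -
  define K where "K = (1 + r) / (1 - r)"
  have K: "K > 0" using assms by (simp add: K_def)
  define g where "g n = 2 / pi * K * real n" for n
  have cot: "cot (pi / (4 * real n)) = cos (pi / (4 * real n)) / sin (pi / (4 * real n))" for n
    by (simp add: cot_def)
  \<comment> \<open>Since cot t ~ 1 / t at 0, half of K cot (pi / (4 n)) is asymptotic to 2 K n /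
    pi, which is \<open>g n\<close>; the additive constant is negligible against this linear
    growth.\<close>
  have lower: "(\<lambda>n. (K * cot (pi / (4 * real n)) - 1) / 2 / g n) \<longlonglongrightarrow> 1"
    unfolding cot g_def using K by real_asymp
  have upper: "(\<lambda>n. (K * cot (pi / (4 * real n)) + 1) / 2 / g n) \<longlonglongrightarrow> 1"
    unfolding cot g_def using K by real_asymp
  have "(\<lambda>n. max_resolvent \<zeta> n r / g n) \<longlonglongrightarrow> 1"
  proof (rule tendsto_sandwich[OF _ _ lower upper])
    show "\<forall>\<^sub>F n in sequentially. (K * cot (pi / (4 * real n)) - 1) / 2 / g n \<le> max_resolvent \<zeta> n r / g n"
      using eventually_gt_at_top[of 0]
    proof eventually_elim
      case (elim n)
      then show ?case
        using max_resolvent_bounds(1)[of r \<zeta> n] assms K by (intro divide_right_mono) (auto simp: K_def g_def)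
    qed
    show "\<forall>\<^sub>F n in sequentially. max_resolvent \<zeta> n r / g n \<le> (K * cot (pi / (4 * real n)) + 1) / 2 / g n"
      using eventually_gt_at_top[of 0]
    proof eventually_elim
      case (elim n)
      then show ?case
        using max_resolvent_bounds(2)[of r \<zeta> n] assms K by (intro divide_right_mono) (auto simp: K_def g_def)
    qed
  qed
  then have "(\<lambda>n. max_resolvent \<zeta> n r) \<sim>[at_top] g" by (rule asymp_equivI')
  then show ?thesis by (simp add: g_def[abs_def] K_def)
qed

end
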